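(* Let $m\ge3$ and $q\ge2$ be integers, and let $T$ be an ordered real $m$-alphabet whose complete short-relation rank is $r=m-3$. Choose a basis of $V$ consisting of deleted rows of $q$-relations vanishing on $T$, whose full balanced vectors have masses $h_1,\dots,h_r\le q$, and put $H=\prod_{i=1}^rh_i$ (with $H=1$ if $r=0$). Then $T$ has a primitive order-preserving integer $q$-model of diameter at most \[ (q+1)H\le q^{m-3}(q+1). \] The universal bound $q^{m-3}(q+1)$ under this rank hypothesis is sharp: for all $m\ge3$, $q\ge2$ there is an ordered real $m$-alphabet of complete short-relation rank $m-3$ whose order-preserving integer $q$-models have minimum diameter exactly $q^{m-3}(q+1)$.
   Context: An ordered real $m$-alphabet is a strictly increasing tuple $T=(t_0<\cdots<t_{m-1})$ of reals. A balanced vector is $\delta\in\mathbb{Z}^m$ with $\sum_i\delta_i=0$; its mass is $\sum_i\max(\delta_i,0)$. A $q$-relation is a balanced vector of mass at most $q$; it vanishes on $T$ if $\delta\cdot T:=\sum_i\delta_it_i=0$. The deleted row of $\delta$ is $(\delta_1,\dots,\delta_{m-1})$. $V\subseteq\mathbb{Q}^{m-1}$ is the rational span of the deleted rows of all $q$-relations vanishing on $T$, and the complete short-relation rank of $T$ is $r=\dim V$. An order-preserving integer $q$-model of $T$ is a strictly increasing integer tuple $T'=(t'_0<\cdots<t'_{m-1})$ such that for every balanced $\delta$ of mass at most $q$, $\delta\cdot T=0$ if and only if $\delta\cdot T'=0$. Its diameter is $t'_{m-1}-t'_0$; it is primitive if, after translating its first letter to $0$, the gcd of its letters is $1$. *)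

theory Defs
  imports Complex_Main "HOL-Library.Function_Algebras"
begin

text \<open>
  An \<open>m\<close>-tuple is a function on \<open>nat\<close> of which only the values at \<open>0, \<dots>, m - 1\<close> matter.
  Integer and rational vectors, whose span and dimension are taken, are in addition required to
  vanish from index \<open>m\<close> (for deleted rows: \<open>m - 1\<close>) on, so that \<open>\<rat>\<^sup>m\<^sup>-\<^sup>1\<close> is the subspace
  of the functions \<open>nat \<Rightarrow> rat\<close> that vanish from \<open>m - 1\<close> on.
\<close>

definition alphabet :: "nat \<Rightarrow> (nat \<Rightarrow> 'a::linorder) \<Rightarrow> bool" where
  "alphabet m T \<longleftrightarrow> strict_mono_on {..<m} T"

definition balanced :: "nat \<Rightarrow> (nat \<Rightarrow> int) \<Rightarrow> bool" where
  "balanced m \<delta> \<longleftrightarrow> (\<forall>i\<ge>m. \<delta> i = 0) \<and> (\<Sum>i<m. \<delta> i) = 0"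

definition mass :: "nat \<Rightarrow> (nat \<Rightarrow> int) \<Rightarrow> int" where
  "mass m \<delta> = (\<Sum>i<m. max (\<delta> i) 0)"

definition q_relation :: "nat \<Rightarrow> nat \<Rightarrow> (nat \<Rightarrow> int) \<Rightarrow> bool" where
  "q_relation m q \<delta> \<longleftrightarrow> balanced m \<delta> \<and> mass m \<delta> \<le> int q"

text \<open>Used both for real alphabets and for their integer models.\<close>

definition vanishes_on :: "nat \<Rightarrow> (nat \<Rightarrow> int) \<Rightarrow> (nat \<Rightarrow> 'a::ring_1) \<Rightarrow> bool" where
  "vanishes_on m \<delta> T \<longleftrightarrow> (\<Sum>i<m. of_int (\<delta> i) * T i) = 0"

definition rat_scale :: "rat \<Rightarrow> (nat \<Rightarrow> rat) \<Rightarrow> (nat \<Rightarrow> rat)" where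
  "rat_scale c f = (\<lambda>i. c * f i)"

interpretation ratvec: vector_space rat_scale
  by unfold_locales (auto simp: rat_scale_def fun_eq_iff algebra_simps)

text \<open>Index shift: entry \<open>j\<close> of the deleted row is \<open>\<delta>\<close> at \<open>j + 1\<close>.\<close>

definition deleted_row :: "(nat \<Rightarrow> int) \<Rightarrow> (nat \<Rightarrow> rat)" where
  "deleted_row \<delta> = (\<lambda>j. of_int (\<delta> (Suc j)))"

definition relation_space :: "nat \<Rightarrow> nat \<Rightarrow> (nat \<Rightarrow> real) \<Rightarrow> (nat \<Rightarrow> rat) set" where
  "relation_space m q T =
     ratvec.span (deleted_row ` {\<delta>. q_relation m q \<delta> \<and> vanishes_on m \<delta> T})"

definition short_relation_rank :: "nat \<Rightarrow> nat \<Rightarrow> (nat \<Rightarrow> real) \<Rightarrow> nat" where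
  "short_relation_rank m q T = ratvec.dim (relation_space m q T)"

definition short_relation_basis ::
    "nat \<Rightarrow> nat \<Rightarrow> (nat \<Rightarrow> real) \<Rightarrow> nat \<Rightarrow> (nat \<Rightarrow> nat \<Rightarrow> int) \<Rightarrow> bool" where
  "short_relation_basis m q T r d \<longleftrightarrow>
     (\<forall>i<r. q_relation m q (d i) \<and> vanishes_on m (d i) T) \<and>
     inj_on (\<lambda>i. deleted_row (d i)) {..<r} \<and>
     ratvec.independent ((\<lambda>i. deleted_row (d i)) ` {..<r}) \<and>
     ratvec.span ((\<lambda>i. deleted_row (d i)) ` {..<r}) = relation_space m q T"

definition integer_q_model :: "nat \<Rightarrow> nat \<Rightarrow> (nat \<Rightarrow> real) \<Rightarrow> (nat \<Rightarrow> int) \<Rightarrow> bool" where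
  "integer_q_model m q T T' \<longleftrightarrow>
     alphabet m T' \<and>
     (\<forall>\<delta>. balanced m \<delta> \<and> mass m \<delta> \<le> int q \<longrightarrow> (vanishes_on m \<delta> T \<longleftrightarrow> vanishes_on m \<delta> T'))"

definition diameter :: "nat \<Rightarrow> (nat \<Rightarrow> int) \<Rightarrow> int" where
  "diameter m T' = T' (m - 1) - T' 0"

definition primitive :: "nat \<Rightarrow> (nat \<Rightarrow> int) \<Rightarrow> bool" where
  "primitive m T' \<longleftrightarrow> Gcd ((\<lambda>i. T' i - T' 0) ` {..<m}) = 1"

end

theory Submission
  imports Defs "Jordan_Normal_Form.Determinant"
begin

text \<open>
  The tuples with first letter \<open>0\<close> that satisfy the \<open>m - 3\<close> basis relations form a plane, and
  the determinant of the deleted rows of \<open>\<kappa>, \<mu>, d\<^sub>1, \<dots>, d\<^sub>r\<close> is an alternating form in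
  \<open>\<kappa>, \<mu>\<close> whose partial evaluation at \<open>\<mu>\<close> is an integer vector on the line of the plane where
  \<open>\<mu>\<close> vanishes. Identifying two letters does not increase masses, and this bounds the form by the
  product of the masses of all rows. An extremal ray of the cone of ordered tuples is cut out by a
  gap, of mass \<open>1\<close>, so it has an integer vector \<open>A\<close> of diameter at most \<open>H\<close>; the next ray cut out
  by a \<open>q\<close>-relation has an integer vector \<open>E\<close> of diameter at most \<open>q H\<close>. Then \<open>A + E\<close> lies
  strictly between two neighbouring rays, so no further \<open>q\<close>-relation vanishes on it.

  The bound is attained by \<open>0, 1, q + 1, q (q + 1), \<dots>, q\<^bsup>m-3\<^esup> (q + 1)\<close>. Its relations force
  every model to multiply the distance \<open>y = t'\<^sub>2 - t'\<^sub>0\<close> by \<open>q\<close> in each further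
  step, and \<open>y \<le> q\<close> is impossible because \<open>y\<close> and \<open>x = t'\<^sub>1 - t'\<^sub>0\<close> would satisfy the
  \<open>q\<close>-relation \<open>y \<cdot> x - x \<cdot> y = 0\<close>.
\<close>

section \<open>Determinants of deleted rows\<close>

definition deleted_det :: "nat \<Rightarrow> (nat \<Rightarrow> nat \<Rightarrow> 'a::comm_ring_1) \<Rightarrow> 'a" where
  "deleted_det n R = det (mat n n (\<lambda>(i, j). R i (Suc j)))"

text \<open>Laplace expansion along row \<open>k\<close>: the cofactors delete that row and hence do
  not depend on \<open>x\<close>.\<close>

lemma deleted_det_linear_row:
  assumes "k < n"
  shows "\<exists>c. \<forall>x. deleted_det n (R(k := x)) = (\<Sum>j<n. x (Suc j) * c j)"
proof -
  let ?M = "\<lambda>x. mat n n (\<lambda>(i, j). (R(k := x)) i (Suc j))"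
  have del: "mat_delete (?M x) k j = mat_delete (?M y) k j" for x y j
    by (rule eq_matI) (auto simp: mat_delete_def)
  have cof: "cofactor (?M x) k j = cofactor (?M 0) k j" for x j
    unfolding cofactor_def del[of x j 0] ..
  have "deleted_det n (R(k := x)) = (\<Sum>j<n. x (Suc j) * cofactor (?M 0) k j)" for x
  proof -
    have "det (?M x) = (\<Sum>j<n. ?M x $$ (k, j) * cofactor (?M x) k j)"
      by (rule laplace_expansion_row) (use assms in auto)
    also have "\<dots> = (\<Sum>j<n. x (Suc j) * cofactor (?M 0) k j)"
      unfolding cof[of x] using assms by (intro sum.cong refl) auto
    finally show ?thesis by (simp add: deleted_det_def)
  qed
  then show ?thesis by (intro exI[of _ "\<lambda>j. cofactor (?M 0) k j"]) blast
qed

lemma deleted_det_repeated_row: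
  assumes "i < n" "j < n" "i \<noteq> j" "R i = R j"
  shows "deleted_det n R = 0"
  unfolding deleted_det_def
  by (rule det_identical_rows[of _ n i j]) (use assms in \<open>auto intro!: eq_vecI\<close>)

lemma deleted_det_swap_rows:
  assumes "k < n" "l < n" "k \<noteq> l"
  shows "deleted_det n (R(k := R l, l := R k)) = - deleted_det n R"
proof -
  let ?M = "mat n n (\<lambda>(i, j). R i (Suc j))"
  have "mat n n (\<lambda>(i, j). (R(k := R l, l := R k)) i (Suc j)) = swaprows k l ?M"
    using assms by (intro eq_matI) (auto simp: mat_swaprows_def)
  then show ?thesis
    using det_swaprows[OF assms, of ?M] by (simp add: deleted_det_def)
qed

lemma deleted_det_kernel:
  fixes R :: "nat \<Rightarrow> nat \<Rightarrow> 'a::idom"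
  assumes "deleted_det n R \<noteq> 0" and "\<And>i. i < n \<Longrightarrow> (\<Sum>j<n. R i (Suc j) * c j) = 0" and "j < n"
  shows "c j = 0"
proof -
  let ?M = "mat n n (\<lambda>(i, j). R i (Suc j))"
  have "?M *\<^sub>v vec n c = 0\<^sub>v n"
    using assms(2) by (intro eq_vecI) (auto simp: scalar_prod_def lessThan_atLeast0)
  moreover have "det ?M \<noteq> 0"
    using assms(1) by (simp add: deleted_det_def)
  ultimately have "vec n c = 0\<^sub>v n"
    using det_0_iff_vec_prod_zero[of ?M n] vec_carrier[of n c] mat_carrier[of n n] by blast
  then show ?thesis
    using assms(3) by (metis index_vec index_zero_vec(1))
qed

lemma deleted_det_nonzero:
  fixes R :: "nat \<Rightarrow> nat \<Rightarrow> 'a::idom"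
  assumes "\<And>c. (\<And>i. i < n \<Longrightarrow> (\<Sum>j<n. R i (Suc j) * c j) = 0) \<Longrightarrow> \<forall>j<n. c j = 0"
  shows "deleted_det n R \<noteq> 0"
proof
  let ?M = "mat n n (\<lambda>(i, j). R i (Suc j))"
  assume "deleted_det n R = 0"
  then obtain v where v: "v \<in> carrier_vec n" "v \<noteq> 0\<^sub>v n" "?M *\<^sub>v v = 0\<^sub>v n"
    using det_0_iff_vec_prod_zero[of ?M n] by (auto simp: deleted_det_def)
  have "(\<Sum>j<n. R i (Suc j) * v $ j) = 0" if "i < n" for i
  proof -
    have "(?M *\<^sub>v v) $ i = (\<Sum>j<n. R i (Suc j) * v $ j)"
      using that v(1) by (auto simp: scalar_prod_def lessThan_atLeast0)
    then show ?thesis using v(3) that by simp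
  qed
  then have "\<forall>j<n. v $ j = 0" by (rule assms)
  then have "v = 0\<^sub>v n" using v(1) by (intro eq_vecI) auto
  then show False using v(2) by simp
qed

lemma of_int_deleted_det:
  "of_int (deleted_det n R) = deleted_det n (\<lambda>i j. of_int (R i j))"
proof -
  have "map_mat of_int (mat n n (\<lambda>(i, j). R i (Suc j))) = mat n n (\<lambda>(i, j). of_int (R i (Suc j)))"
    by (intro eq_matI) auto
  then show ?thesis
    unfolding deleted_det_def using of_int_hom.hom_det by metis
qed

section \<open>Masses, finiteness of the set of q-relations, and differences of letters\<close>

lemma mass_uminus:
  assumes "balanced m \<delta>"
  shows "mass m (- \<delta>) = mass m \<delta>"
proof -
  \<comment> \<open>Entrywise this is \<open>max x 0 - max (- x) 0 = x\<close>, so balance equates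
    the positive total with the negative one.\<close>
  have "mass m \<delta> - mass m (- \<delta>) = (\<Sum>i<m. \<delta> i)"
    unfolding mass_def sum_subtractf[symmetric] by (intro sum.cong) (auto simp: max_def)
  then show ?thesis using assms by (simp add: balanced_def)
qed

lemma mass_nonneg: "0 \<le> mass m \<delta>"
  by (simp add: mass_def sum_nonneg)

lemma q_relation_uminus: "q_relation m q \<delta> \<Longrightarrow> q_relation m q (- \<delta>)"
  by (auto simp: q_relation_def mass_uminus balanced_def sum_negf)

lemma q_relation_abs_le:
  assumes "q_relation m q \<delta>"
  shows "\<bar>\<delta> i\<bar> \<le> int q"
proof (cases "i < m")
  case True
  have le: "\<epsilon> i \<le> mass m \<epsilon>" for \<epsilon>
    unfolding mass_def using True
    by (intro order_trans[OF _ member_le_sum[of i]]) auto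
  show ?thesis
    using le[of \<delta>] le[of "- \<delta>"] assms mass_uminus[of m \<delta>] by (auto simp: q_relation_def)
qed (use assms in \<open>auto simp: q_relation_def balanced_def\<close>)

text \<open>The entries are bounded by \<open>q\<close>. Finiteness is what later allows a relation
  of least slope to be chosen.\<close>

lemma finite_q_relations: "finite {\<delta>. q_relation m q \<delta>}"
proof (rule finite_subset)
  let ?F = "{f. \<forall>i. (i \<in> {..<m} \<longrightarrow> f i \<in> {- int q..int q}) \<and> (i \<notin> {..<m} \<longrightarrow> f i = 0)}"
  show "finite ?F" by (rule finite_set_of_finite_funs) auto
  show "{\<delta>. q_relation m q \<delta>} \<subseteq> ?F"
  proof
    fix \<delta> assume "\<delta> \<in> {\<delta>. q_relation m q \<delta>}"
    then have "q_relation m q \<delta>" by simp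
    then have "\<forall>i\<ge>m. \<delta> i = 0" and "- int q \<le> \<delta> i \<and> \<delta> i \<le> int q" for i
      using q_relation_abs_le[of m q \<delta> i] by (auto simp: q_relation_def balanced_def)
    then show "\<delta> \<in> ?F" by auto
  qed
qed

text \<open>The case \<open>a = Suc j\<close>, \<open>b = j\<close> is the gap between two
  neighbouring letters; the case \<open>b = 0\<close> gives coordinates after the first letter has
  been translated to 0.\<close>

definition unit_diff :: "nat \<Rightarrow> nat \<Rightarrow> nat \<Rightarrow> int" where
  "unit_diff a b = (\<lambda>i. of_bool (i = a) - of_bool (i = b))"

lemma sum_unit_diff:
  fixes x :: "nat \<Rightarrow> 'a::comm_ring_1"
  assumes "a < m" "b < m"
  shows "(\<Sum>i<m. of_int (unit_diff a b i) * x i) = x a - x b"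
proof -
  have "(\<Sum>i<m. of_int (unit_diff a b i) * x i)
      = (\<Sum>i<m. (if i = a then x i else 0) - (if i = b then x i else 0))"
    by (intro sum.cong refl) (auto simp: unit_diff_def)
  also have "\<dots> = x a - x b"
    using assms by (simp only: sum_subtractf sum.delta[OF finite_lessThan]) auto
  finally show ?thesis .
qed

lemma balanced_unit_diff:
  assumes "a < m" "b < m"
  shows "balanced m (unit_diff a b)"
  using sum_unit_diff[OF assms, of "\<lambda>_. 1 :: int"] assms
  by (auto simp: balanced_def unit_diff_def)

lemma mass_unit_diff_le: "mass m (unit_diff a b) \<le> 1"
proof -
  have "mass m (unit_diff a b) \<le> (\<Sum>i<m. if i = a then 1 else 0)"
    unfolding mass_def by (intro sum_mono) (auto simp: unit_diff_def)
  also have "\<dots> \<le> 1" by (simp add: sum.delta)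
  finally show ?thesis .
qed

section \<open>Merging letters and the bound of determinants by masses\<close>

lemma abs_balanced_functional_le:
  assumes bal: "balanced m \<delta>"
    and K: "\<And>a b. a < m \<Longrightarrow> b < m \<Longrightarrow> x a - x b \<le> K"
  shows "\<bar>\<Sum>i<m. \<delta> i * x i\<bar> \<le> mass m \<delta> * (K::int)"
proof (cases "m = 0")
  case True
  then show ?thesis by (simp add: mass_def)
next
  case False
  define u where "u = Max (x ` {..<m})"
  define l where "l = Min (x ` {..<m})"
  have u: "x i \<le> u" and l: "l \<le> x i" if "i < m" for i
    using that by (auto simp: u_def l_def)
  have "u \<in> x ` {..<m}" "l \<in> x ` {..<m}"
    using False by (auto simp: u_def l_def intro!: Max_in Min_in)
  then have ul: "u - l \<le> K" using K by auto
  have neg: "(\<Sum>i<m. max (- \<delta> i) 0) = mass m \<delta>"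
    using mass_uminus[OF bal] by (simp add: mass_def)
  \<comment> \<open>Each positive entry meets a value at most \<open>u\<close>, each negative one a
    value at least \<open>l\<close>, and both kinds of entries have total
    \<open>mass m \<delta>\<close>.\<close>
  have "(\<Sum>i<m. \<delta> i * x i) \<le> (\<Sum>i<m. max (\<delta> i) 0 * u - max (- \<delta> i) 0 * l)"
    using u l by (intro sum_mono) (auto simp: max_def mult_left_mono mult_left_mono_neg)
  also have "\<dots> = mass m \<delta> * (u - l)"
    by (simp add: sum_subtractf sum_distrib_right[symmetric] neg right_diff_distrib)
      (simp add: mass_def)
  finally have up: "(\<Sum>i<m. \<delta> i * x i) \<le> mass m \<delta> * (u - l)" .
  have "(\<Sum>i<m. max (\<delta> i) 0 * l - max (- \<delta> i) 0 * u) \<le> (\<Sum>i<m. \<delta> i * x i)"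
    using u l by (intro sum_mono) (auto simp: max_def mult_left_mono mult_left_mono_neg)
  moreover have "(\<Sum>i<m. max (\<delta> i) 0 * l - max (- \<delta> i) 0 * u) = - (mass m \<delta> * (u - l))"
    by (simp add: sum_subtractf sum_distrib_right[symmetric] neg right_diff_distrib)
      (simp add: mass_def)
  moreover have "mass m \<delta> * (u - l) \<le> mass m \<delta> * K"
    using ul by (intro mult_left_mono) (auto simp: mass_def sum_nonneg)
  ultimately show ?thesis using up by linarith
qed

text \<open>Letter \<open>a\<close> is merged into letter \<open>b\<close>; the letters above \<open>a\<close> move down by one.\<close>

definition contract :: "nat \<Rightarrow> nat \<Rightarrow> (nat \<Rightarrow> int) \<Rightarrow> nat \<Rightarrow> int" where
  "contract a b \<delta> k =
     (let k' = (if k < a then k else Suc k) in \<delta> k' + (if k' = b then \<delta> a else 0))"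

lemma sum_skip:
  fixes f :: "nat \<Rightarrow> int"
  assumes "a \<le> n"
  shows "(\<Sum>k<n. f (if k < a then k else Suc k)) = (\<Sum>k<Suc n. f k) - f a"
  using assms
proof (induction n)
  case (Suc n)
  show ?case
  proof (cases "a = Suc n")
    case True
    have "(\<Sum>k<Suc n. f (if k < a then k else Suc k)) = (\<Sum>k<Suc n. f k)"
      by (intro sum.cong) (auto simp: True)
    then show ?thesis by (simp add: True)
  next
    case False
    then show ?thesis using Suc by simp
  qed
qed simp

lemma balanced_contract:
  assumes "balanced (Suc n) \<delta>" "a \<le> n" "b \<le> n" "a \<noteq> b"
  shows "balanced n (contract a b \<delta>)"
proof -
  have "(\<Sum>k<n. contract a b \<delta> k)
      = (\<Sum>k<Suc n. \<delta> k + (if k = b then \<delta> a else 0)) - (\<delta> a + (if a = b then \<delta> a else 0))"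
    unfolding contract_def Let_def
    by (rule sum_skip[OF assms(2), of "\<lambda>k. \<delta> k + (if k = b then \<delta> a else 0)"])
  also have "\<dots> = 0"
    using assms by (simp only: sum.distrib) (auto simp: balanced_def sum.delta)
  finally show ?thesis
    using assms by (auto simp: balanced_def contract_def)
qed

text \<open>The positive part \<open>max x 0\<close> is subadditive, so adding one entry to another
  cannot increase the sum of the positive parts.\<close>

lemma mass_contract_le:
  assumes "a \<le> n" "b \<le> n" "a \<noteq> b"
  shows "mass n (contract a b \<delta>) \<le> mass (Suc n) \<delta>"
proof -
  have "mass n (contract a b \<delta>)
      = (\<Sum>k<Suc n. max (\<delta> k + (if k = b then \<delta> a else 0)) 0) - max (\<delta> a + (if a = b then \<delta> a else 0)) 0"
    unfolding contract_def Let_def mass_def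
    by (rule sum_skip[OF assms(1), of "\<lambda>k. max (\<delta> k + (if k = b then \<delta> a else 0)) 0"])
  also have "\<dots> \<le> (\<Sum>k<Suc n. max (\<delta> k) 0 + (if k = b then max (\<delta> a) 0 else 0)) - max (\<delta> a) 0"
    using assms by (intro diff_mono sum_mono) auto
  also have "\<dots> = mass (Suc n) \<delta>"
    using assms by (simp only: sum.distrib) (auto simp: mass_def sum.delta)
  finally show ?thesis .
qed

text \<open>Adding the column of letter \<open>a\<close> to that of letter \<open>b\<close> clears
  the entry -1 of row 0 and leaves a single 1 there; expanding along row 0 then leaves the
  contracted rows. Letter \<open>a\<close> sits in column \<open>a - 1\<close>, and for
  \<open>b = 0\<close> the column of \<open>b\<close> is the deleted one, so nothing has to be
  added.\<close>

lemma abs_deleted_det_unit_diff: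
  assumes "0 < a" "a \<le> Suc n" "b \<le> Suc n" "a \<noteq> b" "R 0 = unit_diff a b"
  shows "\<bar>deleted_det (Suc n) R\<bar> = \<bar>deleted_det n (\<lambda>i. contract a b (R (Suc i)))\<bar>"
proof -
  define M where "M = mat (Suc n) (Suc n) (\<lambda>(i, j). R i (Suc j))"
  define M' where "M' = mat (Suc n) (Suc n) (\<lambda>(i, j). R i (Suc j) + (if Suc j = b then R i a else 0))"
  have "det M' = det M"
  proof (cases "b = 0")
    case True
    then have "M' = M" by (auto simp: M_def M'_def)
    then show ?thesis by simp
  next
    case False
    have "M' = addcol 1 (b - 1) (a - 1) M"
      using assms False by (intro eq_matI) (auto simp: M_def M'_def mat_addcol_def)
    also have "det \<dots> = det M"
      by (rule det_addcol[of _ "Suc n"]) (use assms False in \<open>auto simp: M_def\<close>)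
    finally show ?thesis .
  qed
  moreover have "\<bar>det M'\<bar> = \<bar>det (mat_delete M' 0 (a - 1))\<bar>"
  proof -
    have "det M' = (\<Sum>j<Suc n. M' $$ (0, j) * cofactor M' 0 j)"
      by (rule laplace_expansion_row) (auto simp: M'_def)
    also have "\<dots> = (\<Sum>j<Suc n. if j = a - 1 then cofactor M' 0 j else 0)"
      using assms by (intro sum.cong refl) (auto simp: M'_def unit_diff_def)
    also have "\<dots> = cofactor M' 0 (a - 1)"
      using assms by (subst sum.delta) auto
    finally show ?thesis by (simp add: cofactor_def abs_mult power_abs)
  qed
  moreover have "mat_delete M' 0 (a - 1) = mat n n (\<lambda>(i, j). contract a b (R (Suc i)) (Suc j))"
    using assms by (intro eq_matI) (auto simp: mat_delete_def M'_def contract_def Let_def)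
  ultimately show ?thesis by (simp add: deleted_det_def M_def)
qed

text \<open>Induction on the size. As a function of row 0 the determinant is a functional with
  coefficients \<open>x\<close>; a difference \<open>x a - x b\<close> is its value at
  \<open>unit_diff a b\<close>, up to sign a smaller determinant of contracted rows, which the
  induction hypothesis bounds. The mass of row 0 supplies the last factor.\<close>

lemma abs_deleted_det_le:
  assumes "\<And>i. i < n \<Longrightarrow> balanced (Suc n) (R i)"
  shows "\<bar>deleted_det n R\<bar> \<le> (\<Prod>i<n. mass (Suc n) (R i))"
  using assms
proof (induction n arbitrary: R)
  case 0
  show ?case by (simp add: deleted_det_def)
next
  case (Suc n)
  obtain c where c: "deleted_det (Suc n) (R(0 := x)) = (\<Sum>j<Suc n. x (Suc j) * c j)" for x
    using deleted_det_linear_row[of 0 "Suc n" R] by auto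
  \<comment> \<open>The deleted letter gets coefficient 0, so that the functional runs over all
    letters.\<close>
  define x where "x = case_nat 0 c"
  have expand: "deleted_det (Suc n) (R(0 := y)) = (\<Sum>i<Suc (Suc n). y i * x i)" for y
    unfolding c sum.lessThan_Suc_shift[of _ "Suc n"] by (simp add: x_def)
  have diff: "deleted_det (Suc n) (R(0 := unit_diff a b)) = x a - x b"
    if "a < Suc (Suc n)" "b < Suc (Suc n)" for a b
    using sum_unit_diff[OF that, of x] by (simp only: expand of_int_eq_id id_apply)
  let ?K = "\<Prod>i<n. mass (Suc (Suc n)) (R (Suc i))"
  have K0: "0 \<le> ?K"
    by (intro prod_nonneg) (simp add: mass_def sum_nonneg)
  have pos: "\<bar>x a - x b\<bar> \<le> ?K"
    if "0 < a" "a < Suc (Suc n)" "b < Suc (Suc n)" "a \<noteq> b" for a b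
  proof -
    have "\<bar>x a - x b\<bar> = \<bar>deleted_det n (\<lambda>i. contract a b (R (Suc i)))\<bar>"
      using abs_deleted_det_unit_diff[of a n b "R(0 := unit_diff a b)"] that diff[of a b] by simp
    also have "\<dots> \<le> (\<Prod>i<n. mass (Suc n) (contract a b (R (Suc i))))"
      using that by (intro Suc.IH balanced_contract Suc.prems) auto
    also have "\<dots> \<le> ?K"
      using that by (intro prod_mono conjI mass_contract_le) (auto simp: mass_def sum_nonneg)
    finally show ?thesis .
  qed
  \<comment> \<open>Of two different letters at least one is positive, and the absolute value in
    \<open>pos\<close> allows it to be taken as the merged letter.\<close>
  have "x a - x b \<le> ?K" if "a < Suc (Suc n)" "b < Suc (Suc n)" for a b
    using pos[of a b] pos[of b a] that K0 by (cases "a = b"; cases "a = 0") auto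
  then have "\<bar>\<Sum>i<Suc (Suc n). R 0 i * x i\<bar> \<le> mass (Suc (Suc n)) (R 0) * ?K"
    using Suc.prems[of 0] by (intro abs_balanced_functional_le) auto
  then show ?case
    using expand[of "R 0"] by (simp add: prod.lessThan_Suc_shift del: prod.lessThan_Suc sum.lessThan_Suc)
qed

lemma sum_apply: "(\<Sum>i\<in>I. f i) x = (\<Sum>i\<in>I. f i x)"
  by (induction I rule: infinite_finite_induct) auto

lemma span_functional_zero:
  assumes "f \<in> ratvec.span S" and "\<And>g. g \<in> S \<Longrightarrow> (\<Sum>j<n. g j * c j) = 0"
  shows "(\<Sum>j<n. f j * c j) = 0"
  using assms(1)
proof (induction rule: ratvec.span_induct)
  show "ratvec.subspace {f. (\<Sum>j<n. f j * c j) = 0}"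
    by (auto simp: ratvec.subspace_def rat_scale_def distrib_right sum.distrib mult.assoc
        sum_distrib_left[symmetric])
qed (rule assms(2))

section \<open>The alternating form of a basis of relations\<close>

locale short_basis =
  fixes m q :: nat and T :: "nat \<Rightarrow> real" and d :: "nat \<Rightarrow> nat \<Rightarrow> int"
  assumes m: "3 \<le> m" and q: "1 \<le> q" and T: "alphabet m T"
    and basis: "short_relation_basis m q T (m - 3) d"
begin

text \<open>Two free rows complete the \<open>m - 3\<close> basis rows to a square matrix; this is
  where the rank \<open>m - 3\<close> enters.\<close>

definition form :: "(nat \<Rightarrow> int) \<Rightarrow> (nat \<Rightarrow> int) \<Rightarrow> int" where
  "form \<kappa> \<mu> = deleted_det (m - 1) (case_nat \<kappa> (case_nat \<mu> d))"

definition \<tau> :: "(nat \<Rightarrow> int) \<Rightarrow> real" where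
  "\<tau> \<delta> = (\<Sum>i<m. of_int (\<delta> i) * T i)"

lemma basis_relation: "i < m - 3 \<Longrightarrow> q_relation m q (d i)" "i < m - 3 \<Longrightarrow> \<tau> (d i) = 0"
  using basis by (auto simp: short_relation_basis_def vanishes_on_def \<tau>_def)

lemma form_swap: "form \<mu> \<kappa> = - form \<kappa> \<mu>"
proof -
  let ?R = "case_nat \<kappa> (case_nat \<mu> d)"
  have "?R(0 := ?R 1, 1 := ?R 0) = case_nat \<mu> (case_nat \<kappa> d)"
    by (auto simp: fun_eq_iff split: nat.split)
  then show ?thesis
    using deleted_det_swap_rows[of 0 "m - 1" 1 ?R] m by (simp add: form_def)
qed

lemma form_linear: "\<exists>c. \<forall>x. form x \<mu> = (\<Sum>j<m - 1. x (Suc j) * c j)"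
proof -
  have "(case_nat \<kappa> (case_nat \<mu> d))(0 := x) = case_nat x (case_nat \<mu> d)" for x \<kappa>
    by (auto simp: fun_eq_iff split: nat.split)
  then show ?thesis
    using deleted_det_linear_row[of 0 "m - 1" "case_nat \<mu> (case_nat \<mu> d)"] m by (simp add: form_def)
qed

text \<open>The numbers \<open>form (unit_diff i 0) \<mu>\<close> are thus the letters of an integer
  tuple with first letter 0 on which every \<open>x\<close> takes the value
  \<open>form x \<mu>\<close>: the ray cut out by \<open>\<mu>\<close>.\<close>

lemma form_expand: "form x \<mu> = (\<Sum>i<m. x i * form (unit_diff i 0) \<mu>)"
proof -
  obtain c where c: "form x \<mu> = (\<Sum>j<m - 1. x (Suc j) * c j)" for x
    using form_linear by blast
  have *: "form x \<mu> = (\<Sum>i<m. x i * case_nat 0 c i)" for x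
    using m sum.lessThan_Suc_shift[of "\<lambda>i. x i * case_nat 0 c i" "m - 1"] by (simp add: c)
  have "form (unit_diff i 0) \<mu> = case_nat 0 c i" if "i < m" for i
    using sum_unit_diff[OF that, of 0 "case_nat 0 c"] m by (simp add: *)
  then show ?thesis by (simp add: *[of x])
qed

lemma form_unit_diff:
  assumes "a < m" "b < m"
  shows "form (unit_diff a b) \<mu> = form (unit_diff a 0) \<mu> - form (unit_diff b 0) \<mu>"
  using sum_unit_diff[OF assms, of "\<lambda>i. form (unit_diff i 0) \<mu>"]
  by (simp add: form_expand[of "unit_diff a b"])

lemma form_uminus: "form (- x) \<mu> = - form x \<mu>"
  unfolding form_expand[of x] form_expand[of "- x"] by (simp add: sum_negf)

lemma form_self: "form \<kappa> \<kappa> = 0"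
  using form_swap[of \<kappa> \<kappa>] by simp

lemma form_basis:
  assumes "i < m - 3"
  shows "form (d i) \<mu> = 0"
  unfolding form_def by (rule deleted_det_repeated_row[of 0 _ "i + 2"]) (use assms in auto)

lemma abs_form_le:
  assumes "balanced m \<kappa>" "balanced m \<mu>"
  shows "\<bar>form \<kappa> \<mu>\<bar> \<le> mass m \<kappa> * (mass m \<mu> * (\<Prod>i<m - 3. mass m (d i)))"
proof -
  define n where "n = m - 3"
  have m_n: "m = Suc (Suc (Suc n))" using m by (simp add: n_def)
  have "balanced m (d i)" if "i < n" for i
    using basis_relation(1) that by (simp add: n_def q_relation_def)
  then have "\<bar>form \<kappa> \<mu>\<bar> \<le> (\<Prod>i<m - 1. mass (Suc (m - 1)) (case_nat \<kappa> (case_nat \<mu> d) i))"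
    unfolding form_def using assms
    by (intro abs_deleted_det_le) (auto simp: m_n split: nat.split)
  then show ?thesis
    by (simp add: m_n prod.lessThan_Suc_shift del: prod.lessThan_Suc)
qed

section \<open>The three-term identity and the nondegeneracy of the form\<close>

lemma \<tau>_balanced:
  assumes "balanced m \<delta>"
  shows "\<tau> \<delta> = (\<Sum>j<m - 1. of_int (\<delta> (Suc j)) * (T (Suc j) - T 0))"
proof -
  have "(\<Sum>i<m. of_int (\<delta> i) * T 0) = of_int (\<Sum>i<m. \<delta> i) * T 0"
    by (simp add: sum_distrib_right)
  also have "\<dots> = 0" using assms by (simp add: balanced_def)
  finally have "\<tau> \<delta> = (\<Sum>i<m. of_int (\<delta> i) * (T i - T 0))"
    by (simp add: \<tau>_def right_diff_distrib sum_subtractf)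
  then show ?thesis
    using m sum.lessThan_Suc_shift[of "\<lambda>i. of_int (\<delta> i) * (T i - T 0)" "m - 1"] by simp
qed

text \<open>The left-hand side is linear in \<open>\<nu>\<close> and vanishes on \<open>\<kappa>\<close>, \<open>\<mu>\<close> and all basis relations, which
  span everything if \<open>form \<kappa> \<mu> \<noteq> 0\<close>; the identity permutes its three arguments cyclically.\<close>

lemma three_term_if_nonzero:
  assumes bal: "balanced m \<kappa>" "balanced m \<mu>" "balanced m \<nu>" and nz: "form \<kappa> \<mu> \<noteq> 0"
  shows "\<tau> \<kappa> * form \<mu> \<nu> + \<tau> \<mu> * form \<nu> \<kappa> + \<tau> \<nu> * form \<kappa> \<mu> = 0"
proof -
  obtain c1 where c1: "form x \<mu> = (\<Sum>j<m - 1. x (Suc j) * c1 j)" for x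
    using form_linear by blast
  obtain c2 where c2: "form x \<kappa> = (\<Sum>j<m - 1. x (Suc j) * c2 j)" for x
    using form_linear by blast
  \<comment> \<open>The coefficients of the left-hand side of the identity as a functional of the
    deleted row of \<nu>.\<close>
  define c where "c j = \<tau> \<mu> * c2 j - \<tau> \<kappa> * c1 j + (T (Suc j) - T 0) * form \<kappa> \<mu>" for j
  have c: "(\<Sum>j<m - 1. of_int (x (Suc j)) * c j)
      = \<tau> \<mu> * form x \<kappa> - \<tau> \<kappa> * form x \<mu> + \<tau> x * form \<kappa> \<mu>"
    if "balanced m x" for x
    unfolding c1[of x] c2[of x] \<tau>_balanced[OF that] of_int_sum of_int_mult c_def
      sum_distrib_left sum_distrib_right sum.distrib[symmetric] sum_subtractf[symmetric]
    by (intro sum.cong refl) (simp add: algebra_simps)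
  have "(\<Sum>j<m - 1. of_int (case_nat \<kappa> (case_nat \<mu> d) i (Suc j)) * c j) = 0" if i: "i < m - 1" for i
  proof (cases i)
    case 0
    then show ?thesis using c[OF bal(1)] by (simp add: form_self)
  next
    case (Suc i')
    show ?thesis
    proof (cases i')
      case 0
      then show ?thesis
        using c[OF bal(2)] Suc form_swap[of \<mu> \<kappa>] by (simp add: form_self)
    next
      case (Suc k)
      then have "k < m - 3" using i \<open>i = Suc i'\<close> by simp
      then have "balanced m (d k)" "\<tau> (d k) = 0" "form (d k) x = 0" for x
        using basis_relation form_basis by (auto simp: q_relation_def)
      then show ?thesis
        using c[of "d k"] Suc \<open>i = Suc i'\<close> by simp
    qed
  qed
  moreover have "deleted_det (m - 1) (\<lambda>i j. of_int (case_nat \<kappa> (case_nat \<mu> d) i j)) \<noteq> (0 :: real)"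
    using nz unfolding of_int_deleted_det[symmetric] by (simp add: form_def)
  ultimately have "c j = 0" if "j < m - 1" for j
    using deleted_det_kernel that by blast
  then show ?thesis
    using c[OF bal(3)] form_swap[of \<mu> \<nu>] by simp
qed

text \<open>If all three forms vanish, so does every term; otherwise a rotation moves a nonzero form
  to the place required by \<open>three_term_if_nonzero\<close>.\<close>

lemma three_term:
  assumes bal: "balanced m \<kappa>" "balanced m \<mu>" "balanced m \<nu>"
  shows "\<tau> \<kappa> * form \<mu> \<nu> + \<tau> \<mu> * form \<nu> \<kappa> + \<tau> \<nu> * form \<kappa> \<mu> = 0"
  using three_term_if_nonzero[OF bal] three_term_if_nonzero[OF bal(2,3,1)] three_term_if_nonzero[OF bal(3,1,2)]
  by fastforce

text \<open>The basis spans the deleted rows of all vanishing q-relations, and a functional that is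
  zero on the basis is zero on its span.\<close>

lemma form_vanishing:
  assumes "q_relation m q \<delta>" "\<tau> \<delta> = 0"
  shows "form \<delta> \<mu> = 0"
proof -
  obtain c where c: "form x \<mu> = (\<Sum>j<m - 1. x (Suc j) * c j)" for x
    using form_linear by blast
  have row: "(\<Sum>j<m - 1. deleted_row x j * of_int (c j)) = of_int (form x \<mu>)" for x
    by (simp add: c deleted_row_def)
  have "deleted_row \<delta> \<in> relation_space m q T"
    unfolding relation_space_def
    by (rule ratvec.span_base) (use assms in \<open>auto simp: vanishes_on_def \<tau>_def\<close>)
  then have "deleted_row \<delta> \<in> ratvec.span ((\<lambda>i. deleted_row (d i)) ` {..<m - 3})"
    using basis by (simp add: short_relation_basis_def)
  then have "(\<Sum>j<m - 1. deleted_row \<delta> j * of_int (c j)) = 0"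
    by (rule span_functional_zero) (auto simp: row[simplified] form_basis)
  then show ?thesis unfolding row by simp
qed

text \<open>Basis extension: the \<open>m - 3\<close> independent rows are completed to a basis of
  the \<open>(m - 1)\<close>-dimensional space by exactly two unit vectors, and these serve as
  \<kappa> and \<mu>.\<close>

lemma form_nonzero:
  obtains \<kappa> \<mu> where "balanced m \<kappa>" "balanced m \<mu>" "form \<kappa> \<mu> \<noteq> 0"
proof -
  let ?n = "m - 1"
  let ?B = "(\<lambda>i. deleted_row (d i)) ` {..<m - 3}"
  \<comment> \<open>The unit vectors are written as deleted rows of balanced vectors, so that the
    two rows added come from balanced vectors.\<close>
  define e where "e j = deleted_row (unit_diff (Suc j) 0)" for j
  have e: "e j k = of_bool (k = j)" for j k
    by (simp add: e_def deleted_row_def unit_diff_def)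
  have inj: "inj_on e {..<?n}"
    by (rule inj_onI) (metis e of_bool_eq_iff)
  have supp: "f \<in> ratvec.span (e ` {..<?n})" if "\<And>k. ?n \<le> k \<Longrightarrow> f k = 0" for f
  proof -
    have "f = (\<Sum>j<?n. rat_scale (f j) (e j))"
    proof
      fix k
      have "(\<Sum>j<?n. rat_scale (f j) (e j)) k = (\<Sum>j<?n. if j = k then f j else 0)"
        unfolding sum_apply by (intro sum.cong) (auto simp: rat_scale_def e)
      then show "f k = (\<Sum>j<?n. rat_scale (f j) (e j)) k"
        using that[of k] by (auto simp: sum.delta)
    qed
    then show ?thesis
      by (metis (no_types, lifting) ratvec.span_sum ratvec.span_scale ratvec.span_base imageI)
  qed
  have ind: "ratvec.independent ?B" and inj_d: "inj_on (\<lambda>i. deleted_row (d i)) {..<m - 3}"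
    using basis by (auto simp: short_relation_basis_def)
  have B_span: "?B \<subseteq> ratvec.span (e ` {..<?n})"
  proof (intro image_subsetI supp)
    fix i k assume "i \<in> {..<m - 3}" "?n \<le> k"
    then show "deleted_row (d i) k = 0"
      using basis_relation(1)[of i] by (auto simp: deleted_row_def q_relation_def balanced_def)
  qed
  have ind_e: "ratvec.independent (e ` {..<?n})"
  proof (rule ratvec.independent_if_scalars_zero)
    fix f x assume sum0: "(\<Sum>x\<in>e ` {..<?n}. rat_scale (f x) x) = 0" and "x \<in> e ` {..<?n}"
    then obtain k where k: "x = e k" "k < ?n" by auto
    have "0 = (\<Sum>j<?n. rat_scale (f (e j)) (e j)) k"
      using sum0 unfolding sum.reindex[OF inj] o_def by simp
    also have "\<dots> = (\<Sum>j<?n. if j = k then f (e j) else 0)"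
      unfolding sum_apply by (intro sum.cong) (auto simp: rat_scale_def e)
    finally show "f x = 0" using k by (simp add: sum.delta)
  qed simp
  obtain t where t: "?B \<subseteq> t" "t \<subseteq> ?B \<union> e ` {..<?n}" "ratvec.independent t"
      "?B \<union> e ` {..<?n} \<subseteq> ratvec.span t"
    by (rule ratvec.maximal_independent_subset_extend[OF Un_upper1 ind])
  have fin: "finite t" using t(2) by (rule finite_subset) simp
  have "t \<subseteq> ratvec.span (e ` {..<?n})"
    using t(2) B_span ratvec.span_superset[of "e ` {..<?n}"] by blast
  then have "card t \<le> card (e ` {..<?n})"
    using ratvec.independent_span_bound[OF _ t(3)] by simp
  moreover have "card (e ` {..<?n}) \<le> card t"
    using ratvec.independent_span_bound[OF fin ind_e] t(4) by simp
  moreover have "card (e ` {..<?n}) = ?n" by (subst card_image[OF inj]) simp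
  ultimately have "card t = ?n" by linarith
  then have "card (t - ?B) = 2"
    using card_Diff_subset[of ?B t] t(1) card_image[OF inj_d] m by simp
  then obtain a b where ab: "t - ?B = {a, b}"
    unfolding card_2_iff by blast
  have "a \<in> e ` {..<?n}" "b \<in> e ` {..<?n}"
    using ab t(2) by blast+
  then obtain i j where ij: "a = e i" "i < ?n" "b = e j" "j < ?n"
    by auto
  let ?R = "case_nat (unit_diff (Suc i) 0) (case_nat (unit_diff (Suc j) 0) d)"
  \<comment> \<open>A kernel vector annihilates \<open>t\<close>, hence its span, which contains
    every unit vector; so all its entries are 0.\<close>
  have "deleted_det ?n ?R \<noteq> 0"
  proof (rule deleted_det_nonzero)
    fix c :: "nat \<Rightarrow> int"
    assume c: "(\<Sum>j<?n. ?R i (Suc j) * c j) = 0" if "i < ?n" for i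
    have row: "(\<Sum>j<?n. deleted_row x j * of_int (c j)) = of_int (\<Sum>j<?n. x (Suc j) * c j)" for x
      by (simp add: deleted_row_def)
    have zero: "(\<Sum>j<?n. g j * of_int (c j)) = 0" if "g \<in> t" for g
    proof -
      from that ab ij consider "g = e i" | "g = e j" | k where "k < m - 3" "g = deleted_row (d k)"
        by auto
      then show ?thesis
      proof cases
        case 1
        then show ?thesis using c[of 0] m unfolding e_def row 1 by simp
      next
        case 2
        then show ?thesis using c[of 1] m unfolding e_def row 2 by simp
      next
        case 3
        then show ?thesis using c[of "Suc (Suc k)"] m unfolding row 3 by simp
      qed
    qed
    show "\<forall>k<?n. c k = 0"
    proof (intro allI impI)
      fix k assume k: "k < ?n"
      have "(\<Sum>j<?n. e k j * of_int (c j)) = 0"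
        by (rule span_functional_zero[OF _ zero]) (use t(4) k in auto)
      moreover have "(\<Sum>j<?n. e k j * of_int (c j)) = (\<Sum>j<?n. if j = k then of_int (c j) else 0)"
        by (intro sum.cong) (auto simp: e)
      ultimately show "c k = 0" using k by (simp add: sum.delta)
    qed
  qed
  then have "form (unit_diff (Suc i) 0) (unit_diff (Suc j) 0) \<noteq> 0"
    unfolding form_def .
  then show ?thesis
    by (rule that[rotated 2]) (use ij in \<open>auto intro: balanced_unit_diff\<close>)
qed

end

section \<open>A model of small diameter\<close>

text \<open>Balanced vectors do not notice a translation, and division by the positive gcd rescales
  all their values by one factor.\<close>

lemma integer_q_model_primitive:
  assumes m: "2 \<le> m" and model: "integer_q_model m q T T'"
  obtains T'' where "integer_q_model m q T T''" "primitive m T''" "diameter m T'' \<le> diameter m T'"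
proof -
  define g where "g = Gcd ((\<lambda>i. T' i - T' 0) ` {..<m})"
  define T'' where "T'' i = (T' i - T' 0) div g" for i
  have mono: "T' i < T' j" if "i < j" "j < m" for i j
    using model that by (auto simp: integer_q_model_def alphabet_def strict_mono_on_def)
  have g: "g * T'' i = T' i - T' 0" if "i < m" for i
    using that unfolding T''_def g_def by (intro dvd_mult_div_cancel Gcd_dvd) auto
  have "g \<noteq> 0" using g[of 1] mono[of 0 1] m by auto
  moreover have "0 \<le> g" unfolding g_def by simp
  ultimately have g0: "0 < g" by simp
  have "g * Gcd (T'' ` {..<m}) = g"
  proof -
    have "(\<lambda>i. T' i - T' 0) ` {..<m} = (*) g ` T'' ` {..<m}"
      unfolding image_image using g by (intro image_cong) auto
    then have "g = normalize (g * Gcd (T'' ` {..<m}))"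
      unfolding g_def[symmetric] by (metis Gcd_mult g_def)
    then show ?thesis using g0 by (simp add: abs_mult)
  qed
  then have "Gcd (T'' ` {..<m}) = 1" using g0 by simp
  moreover have T0: "T'' 0 = 0" by (simp add: T''_def)
  ultimately have prim: "primitive m T''" by (simp add: primitive_def)
  have "T'' i < T'' j" if "i < j" "j < m" for i j
  proof -
    have "g * T'' i < g * T'' j" using g[of i] g[of j] mono[OF that] that by simp
    then show ?thesis using g0 by simp
  qed
  then have "alphabet m T''" by (auto simp: alphabet_def strict_mono_on_def)
  moreover have "vanishes_on m \<delta> T'' \<longleftrightarrow> vanishes_on m \<delta> T'" if "balanced m \<delta>" for \<delta>
  proof -
    have "g * (\<Sum>i<m. \<delta> i * T'' i) = (\<Sum>i<m. \<delta> i * (T' i - T' 0))"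
      unfolding sum_distrib_left 
      by (intro sum.cong refl) (simp only: mult.left_commute[of g] g lessThan_iff)
    also have "\<dots> = (\<Sum>i<m. \<delta> i * T' i) - (\<Sum>i<m. \<delta> i) * T' 0"
      by (simp add: right_diff_distrib sum_subtractf sum_distrib_right)
    finally show ?thesis
      using that g0 by (auto simp: vanishes_on_def balanced_def)
  qed
  ultimately have model'': "integer_q_model m q T T''"
    using model by (simp add: integer_q_model_def)
  have "diameter m T'' \<le> diameter m T'"
  proof -
    have "0 < g * T'' (m - 1)"
      using g[of "m - 1"] mono[of 0 "m - 1"] m by simp
    then have "0 \<le> T'' (m - 1)"
      using g0 by (simp add: zero_less_mult_iff)
    then have "1 * T'' (m - 1) \<le> g * T'' (m - 1)" using g0 by (intro mult_right_mono) auto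
    then show ?thesis using g[of "m - 1"] m by (simp add: diameter_def T0)
  qed
  then show ?thesis using that model'' prim by blast
qed

section \<open>Rays of the cone of ordered tuples and the model between two of them\<close>

context short_basis
begin

lemma \<tau>_unit_diff: "a < m \<Longrightarrow> b < m \<Longrightarrow> \<tau> (unit_diff a b) = T a - T b"
  by (simp add: \<tau>_def sum_unit_diff)

lemma \<tau>_gap_pos:
  assumes "j < m - 1"
  shows "0 < \<tau> (unit_diff (Suc j) j)"
proof -
  have "T j < T (Suc j)"
    using T assms by (intro strict_mono_onD[of "{..<m}" T]) (auto simp: alphabet_def)
  then show ?thesis using assms by (simp add: \<tau>_unit_diff)
qed

text \<open>By the three-term identity, on relations with \<open>\<tau> > 0\<close> the sign of the form compares the slopes
  \<open>form \<delta> \<nu> / \<tau> \<delta>\<close>, so a gap of minimal slope cuts out an extremal ray.\<close>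

lemma exists_order_cone_ray:
  obtains k where "k < m - 1" "\<And>j. j < m - 1 \<Longrightarrow> 0 \<le> form (unit_diff (Suc j) j) (unit_diff (Suc k) k)"
proof -
  let ?g = "\<lambda>j. unit_diff (Suc j) j"
  \<comment> \<open>The first gap serves as the reference relation \<nu> of the slopes.\<close>
  define s where "s j = form (?g j) (?g 0) / \<tau> (?g j)" for j
  note pos = \<tau>_gap_pos
  have ne: "{..<m - 1} \<noteq> {}" using m by (auto simp: lessThan_empty_iff)
  obtain k where k: "k < m - 1" "\<And>j. j < m - 1 \<Longrightarrow> s k \<le> s j"
    using arg_min_if_finite(1)[OF finite_lessThan ne, of s]
      arg_min_least[OF finite_lessThan ne, of _ s] by blast
  have "0 \<le> form (?g j) (?g k)" if j: "j < m - 1" for j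
  proof -
    have "\<tau> (?g 0) * form (?g j) (?g k) = \<tau> (?g k) * form (?g j) (?g 0) - \<tau> (?g j) * form (?g k) (?g 0)"
      using three_term[of "?g j" "?g k" "?g 0"] form_swap[of "?g 0" "?g j"] j k(1) m
      by (simp add: balanced_unit_diff)
    also have "\<dots> = \<tau> (?g k) * \<tau> (?g j) * (s j - s k)"
      using pos[OF j] pos[OF k(1)] by (simp add: s_def field_simps)
    also have "\<dots> \<ge> 0"
      using pos[OF j] pos[OF k(1)] k(2)[OF j] by simp
    finally show ?thesis
      using pos[of 0] m by (simp add: zero_le_mult_iff)
  qed
  then show ?thesis using that k(1) by blast
qed

text \<open>The gaps add up to all differences from the first letter. If all of them vanished
  against \<gamma>, so would every \<open>form x \<gamma>\<close>, and the three-term identity would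
  reduce to \<open>\<tau> \<gamma> * form \<kappa> \<mu> = 0\<close> for all \<kappa> and \<mu>,
  contrary to \<open>form_nonzero\<close>.\<close>

lemma form_gap_nonzero:
  assumes \<gamma>: "balanced m \<gamma>" "\<tau> \<gamma> \<noteq> 0"
  obtains j where "j < m - 1" "form (unit_diff (Suc j) j) \<gamma> \<noteq> 0"
proof (rule ccontr)
  assume "\<not> thesis"
  then have gap: "form (unit_diff (Suc j) j) \<gamma> = 0" if "j < m - 1" for j
    using that \<open>\<And>j. j < m - 1 \<Longrightarrow> form (unit_diff (Suc j) j) \<gamma> \<noteq> 0 \<Longrightarrow> thesis\<close> by blast
  have "form (unit_diff i 0) \<gamma> = 0" if "i < m" for i
    using that
  proof (induction i)
    case 0
    then show ?case using form_unit_diff[of 0 0 \<gamma>] by simp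
  next
    case (Suc i)
    then show ?case using form_unit_diff[of "Suc i" i \<gamma>] gap[of i] by simp
  qed
  then have zero: "form x \<gamma> = 0" for x
    unfolding form_expand[of x] by simp
  obtain \<kappa> \<mu> where "balanced m \<kappa>" "balanced m \<mu>" "form \<kappa> \<mu> \<noteq> 0"
    using form_nonzero by blast
  then show False
    using three_term[of \<kappa> \<mu> \<gamma>] \<gamma> form_swap[of \<gamma> \<kappa>] zero by simp
qed

lemma exists_primitive_model:
  "\<exists>T'. integer_q_model m q T T' \<and> primitive m T' \<and>
      diameter m T' \<le> (int q + 1) * (\<Prod>i<m - 3. mass m (d i))"
proof -
  let ?H = "\<Prod>i<m - 3. mass m (d i)"
  have H0: "0 \<le> ?H" by (intro prod_nonneg) (simp add: mass_nonneg)
  obtain k where k: "k < m - 1"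
    and cone: "\<And>j. j < m - 1 \<Longrightarrow> 0 \<le> form (unit_diff (Suc j) j) (unit_diff (Suc k) k)"
    using exists_order_cone_ray by blast
  define \<gamma> where "\<gamma> = unit_diff (Suc k) k"
  note gap_pos = \<tau>_gap_pos
  have gap_rel: "q_relation m q (unit_diff (Suc j) j)" if "j < m - 1" for j
    using that q mass_unit_diff_le[of m "Suc j" j]
    by (auto simp: q_relation_def intro: balanced_unit_diff)
  have \<gamma>: "balanced m \<gamma>" "0 < \<tau> \<gamma>" "mass m \<gamma> \<le> 1"
    using k gap_pos by (auto simp: \<gamma>_def mass_unit_diff_le intro: balanced_unit_diff)
  \<comment> \<open>Signs are normalised: a q-relation that does not vanish on the ray of \<gamma>
    lies in \<open>?S\<close> either itself or after negation.\<close>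
  let ?S = "{\<delta>. q_relation m q \<delta> \<and> 0 < form \<delta> \<gamma>}"
  \<comment> \<open>Moving from the ray of \<open>\<gamma>\<close> into the cone, the relation of least slope \<open>u\<close> is the first to vanish.\<close>
  define u where "u \<delta> = \<tau> \<delta> / form \<delta> \<gamma>" for \<delta>
  have finS: "finite ?S"
    by (rule finite_subset[OF _ finite_q_relations]) auto
  obtain j0 where "j0 < m - 1" "form (unit_diff (Suc j0) j0) \<gamma> \<noteq> 0"
    using form_gap_nonzero[OF \<gamma>(1)] \<gamma>(2) by (metis less_irrefl)
  then have "unit_diff (Suc j0) j0 \<in> ?S"
    using cone[of j0] gap_rel[of j0] by (simp add: \<gamma>_def)
  then have neS: "?S \<noteq> {}" by blast
  obtain \<epsilon> where \<epsilon>: "\<epsilon> \<in> ?S" "\<And>\<delta>. \<delta> \<in> ?S \<Longrightarrow> u \<epsilon> \<le> u \<delta>"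
    using arg_min_if_finite(1)[OF finS neS, of u] arg_min_least[OF finS neS, of _ u] by blast
  have \<epsilon>bal: "balanced m \<epsilon>" and \<epsilon>mass: "mass m \<epsilon> \<le> int q" and \<epsilon>pos: "0 < form \<epsilon> \<gamma>"
    using \<epsilon>(1) by (auto simp: q_relation_def)
  \<comment> \<open>On balanced vectors this expresses \<open>form \<epsilon> \<gamma>\<close> times
    the values on \<open>T\<close> as a combination of the values on the two rays, with coefficients
    \<open>\<tau> \<gamma>\<close> and \<open>\<tau> \<epsilon>\<close>.\<close>
  have key: "\<tau> \<gamma> * form \<epsilon> \<delta> = \<tau> \<delta> * form \<epsilon> \<gamma> - \<tau> \<epsilon> * form \<delta> \<gamma>" if "balanced m \<delta>" for \<delta>
    using three_term[OF \<gamma>(1) \<epsilon>bal that] form_swap[of \<gamma> \<epsilon>] by simp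
  \<comment> \<open>Since \<epsilon> has the least slope, no relation positive on the first ray is
    negative on the second.\<close>
  have E_nonneg: "0 \<le> form \<epsilon> \<delta>" if "\<delta> \<in> ?S" for \<delta>
  proof -
    have "\<tau> \<gamma> * form \<epsilon> \<delta> = \<tau> \<delta> * form \<epsilon> \<gamma> - \<tau> \<epsilon> * form \<delta> \<gamma>"
      using key[of \<delta>] that by (simp add: q_relation_def)
    also have "\<dots> = form \<delta> \<gamma> * form \<epsilon> \<gamma> * (u \<delta> - u \<epsilon>)"
      using that \<epsilon>pos by (simp add: u_def field_simps)
    also have "\<dots> \<ge> 0" using that \<epsilon>pos \<epsilon>(2)[OF that] by simp
    finally show ?thesis using \<gamma>(2) by (simp add: zero_le_mult_iff)
  qed
  \<comment> \<open>The two summands are the values of \<delta> on the integer vectors A and E, so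
    \<open>T'\<close> is A + E.\<close>
  define P where "P \<delta> = form \<delta> \<gamma> + form \<epsilon> \<delta>" for \<delta>
  define T' where "T' i = P (unit_diff i 0)" for i
  have P: "P \<delta> = (\<Sum>i<m. \<delta> i * T' i)" for \<delta>
  proof -
    have "form \<epsilon> \<delta> = - form \<delta> \<epsilon>" by (rule form_swap)
    also have "\<dots> = (\<Sum>i<m. \<delta> i * (- form (unit_diff i 0) \<epsilon>))"
      unfolding form_expand[of \<delta>] by (simp add: sum_negf)
    also have "\<dots> = (\<Sum>i<m. \<delta> i * form \<epsilon> (unit_diff i 0))"
      by (simp only: form_swap[of \<epsilon> "unit_diff _ 0"])
    finally show ?thesis
      unfolding P_def T'_def form_expand[of \<delta> \<gamma>] by (simp add: distrib_left sum.distrib)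
  qed
  have P_diff: "P (unit_diff a b) = T' a - T' b" if "a < m" "b < m" for a b
    unfolding P using sum_unit_diff[OF that, of T'] by simp
  have P_pos: "0 < P \<delta>" if "\<delta> \<in> ?S" for \<delta>
    using E_nonneg[OF that] that by (simp add: P_def)
  have step: "T' j < T' (Suc j)" if j: "j < m - 1" for j
  proof -
    have "0 < P (unit_diff (Suc j) j)"
    proof (cases "form (unit_diff (Suc j) j) \<gamma> = 0")
      case True
      \<comment> \<open>A gap that is zero on the first ray has, by \<open>key\<close>, the same
        sign on the second ray as on \<open>T\<close>.\<close>
      have "0 < \<tau> (unit_diff (Suc j) j) * form \<epsilon> \<gamma>"
        using gap_pos[OF j] \<epsilon>pos by simp
      also have "\<dots> = \<tau> \<gamma> * form \<epsilon> (unit_diff (Suc j) j)"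
        using key[of "unit_diff (Suc j) j"] True j by (simp add: balanced_unit_diff)
      finally show ?thesis using \<gamma>(2) True by (simp add: P_def zero_less_mult_iff)
    next
      case False
      then show ?thesis
        using cone[OF j] gap_rel[OF j] by (intro P_pos) (simp add: \<gamma>_def)
    qed
    then show ?thesis using P_diff[of "Suc j" j] j by simp
  qed
  have mono: "T' i < T' j" if "i < j" "j < m" for i j
    using that
  proof (induction j)
    case (Suc j)
    have "T' j < T' (Suc j)" using step[of j] Suc.prems by simp
    then show ?case using Suc by (cases "i = j") auto
  qed simp
  have nonzero: "P \<delta> = 0 \<longleftrightarrow> \<tau> \<delta> = 0" if rel: "q_relation m q \<delta>" for \<delta>
  proof (cases "\<tau> \<delta> = 0")
    case True
    then show ?thesis using rel form_vanishing form_swap[of \<delta> \<epsilon>] by (simp add: P_def)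
  next
    case False
    \<comment> \<open>Off the first ray the signs on the two rays cannot cancel; a relation zero on
      the first ray is nonzero on the second by \<open>key\<close>.\<close>
    consider "\<delta> \<in> ?S" | "- \<delta> \<in> ?S" | "form \<delta> \<gamma> = 0"
      using rel q_relation_uminus[OF rel] form_uminus[of \<delta> \<gamma>] by fastforce
    then have "P \<delta> \<noteq> 0"
    proof cases
      case 1
      then show ?thesis using P_pos by force
    next
      case 2
      have "P (- \<delta>) = - P \<delta>" unfolding P by (simp add: sum_negf)
      then show ?thesis using P_pos[OF 2] by simp
    next
      case 3
      then have "form \<epsilon> \<delta> \<noteq> 0"
        using key[of \<delta>] rel \<epsilon>pos \<gamma>(2) False by (auto simp: q_relation_def)
      then show ?thesis using 3 by (simp add: P_def)
    qed
    then show ?thesis using False by simp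
  qed
  have model: "integer_q_model m q T T'"
    unfolding integer_q_model_def alphabet_def
  proof (intro conjI allI impI)
    show "strict_mono_on {..<m} T'" using mono by (auto simp: strict_mono_on_def)
    fix \<delta> assume "balanced m \<delta> \<and> mass m \<delta> \<le> int q"
    then show "vanishes_on m \<delta> T \<longleftrightarrow> vanishes_on m \<delta> T'"
      using nonzero[of \<delta>] by (simp add: q_relation_def vanishes_on_def \<tau>_def P)
  qed
  have "2 \<le> m" using m by simp
  obtain T'' where T'': "integer_q_model m q T T''" "primitive m T''"
    "diameter m T'' \<le> diameter m T'"
    by (rule integer_q_model_primitive[OF \<open>2 \<le> m\<close> model])
  have "diameter m T' \<le> (int q + 1) * ?H"
  proof -
    \<comment> \<open>The diameter is the value of \<open>P\<close> at a vector of mass at most 1.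
      Since \<gamma> has mass at most 1 and \<epsilon> mass at most \<open>q\<close>, the two
      summands are at most \<open>?H\<close> and \<open>q\<close> times \<open>?H\<close>.\<close>
    let ?D = "unit_diff (m - 1) 0"
    have D: "balanced m ?D" "mass m ?D \<le> 1"
      using m by (auto simp: mass_unit_diff_le intro: balanced_unit_diff)
    have le: "form \<kappa> \<mu> \<le> c * (1 * ?H)"
      if "balanced m \<kappa>" "balanced m \<mu>" "mass m \<kappa> \<le> c" "mass m \<mu> \<le> 1" "0 \<le> c" for \<kappa> \<mu> c
    proof -
      have "form \<kappa> \<mu> \<le> mass m \<kappa> * (mass m \<mu> * ?H)"
        using abs_form_le[OF that(1,2)] by linarith
      also have "\<dots> \<le> c * (1 * ?H)"
        using that H0 by (intro mult_mono mult_nonneg_nonneg) (auto simp: mass_nonneg)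
      finally show ?thesis .
    qed
    have "form ?D \<gamma> \<le> 1 * (1 * ?H)"
      using D \<gamma> by (intro le) auto
    moreover have "form \<epsilon> ?D \<le> int q * (1 * ?H)"
      using D \<epsilon>bal \<epsilon>mass by (intro le) auto
    moreover have "diameter m T' = P ?D"
      using P_diff[of "m - 1" 0] m by (simp add: diameter_def)
    ultimately show ?thesis by (simp add: P_def algebra_simps)
  qed
  then have "diameter m T'' \<le> (int q + 1) * ?H" using T''(3) by (rule order_trans[rotated])
  then show ?thesis using T''(1,2) by blast
qed

end

section \<open>Existence of a basis consisting of relation rows\<close>

lemma exists_short_relation_basis:
  assumes "short_relation_rank m q T = r"
  shows "\<exists>d. short_relation_basis m q T r d"
proof -
  let ?R = "{\<delta>. q_relation m q \<delta> \<and> vanishes_on m \<delta> T}"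
  \<comment> \<open>The basis is extracted from the generating rows themselves, so that each of its
    elements can be lifted back to a q-relation.\<close>
  obtain B where B: "B \<subseteq> deleted_row ` ?R" "ratvec.independent B"
      "deleted_row ` ?R \<subseteq> ratvec.span B"
    by (rule ratvec.maximal_independent_subset)
  have "finite ?R" by (rule finite_subset[OF _ finite_q_relations]) auto
  then have fin: "finite B" by (rule finite_subset[OF B(1) finite_imageI])
  have span: "ratvec.span B = relation_space m q T"
    unfolding relation_space_def using B(1,3) ratvec.span_superset[of "deleted_row ` ?R"]
    by (subst ratvec.span_eq) blast
  have "ratvec.dim (relation_space m q T) = card B"
    unfolding span[symmetric] by (rule ratvec.dim_span_eq_card_independent[OF B(2)])
  then have "card B = r" using assms by (simp add: short_relation_rank_def)
  then have "\<exists>h. bij_betw h {..<r} B"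
    using ex_bij_betw_nat_finite[OF fin] by (simp add: lessThan_atLeast0)
  then obtain h where h: "bij_betw h {..<r} B" ..
  have "\<exists>\<delta>. \<delta> \<in> ?R \<and> deleted_row \<delta> = h i" if "i < r" for i
  proof -
    have "h i \<in> B" using bij_betwE[OF h] that by simp
    then have "h i \<in> deleted_row ` ?R" by (rule subsetD[OF B(1)])
    then obtain \<delta> where "h i = deleted_row \<delta>" "\<delta> \<in> ?R" by (rule imageE)
    then show ?thesis by (intro exI[of _ \<delta>]) simp
  qed
  then obtain d where d: "d i \<in> ?R" "deleted_row (d i) = h i" if "i < r" for i
    by metis
  have "(\<lambda>i. deleted_row (d i)) ` {..<r} = B"
    unfolding bij_betw_imp_surj_on[OF h, symmetric] using d(2) by (intro image_cong) auto
  moreover have "inj_on (\<lambda>i. deleted_row (d i)) {..<r}"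
    using bij_betw_imp_inj_on[OF h] by (subst inj_on_cong[of _ _ h]) (auto simp: d(2))
  ultimately show ?thesis
    using d(1) B(2) span by (intro exI[of _ d]) (auto simp: short_relation_basis_def)
qed

section \<open>Sharpness\<close>

definition two_term :: "int \<Rightarrow> nat \<Rightarrow> int \<Rightarrow> nat \<Rightarrow> nat \<Rightarrow> int" where
  "two_term a p b r = (\<lambda>i. a * unit_diff p 0 i - b * unit_diff r 0 i)"

lemma sum_two_term:
  fixes x :: "nat \<Rightarrow> 'a::comm_ring_1"
  assumes "p < m" "r < m"
  shows "(\<Sum>i<m. of_int (two_term a p b r i) * x i) = of_int a * (x p - x 0) - of_int b * (x r - x 0)"
proof -
  have "(\<Sum>i<m. of_int (two_term a p b r i) * x i)
      = of_int a * (\<Sum>i<m. of_int (unit_diff p 0 i) * x i)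
        - of_int b * (\<Sum>i<m. of_int (unit_diff r 0 i) * x i)"
    unfolding sum_distrib_left sum_subtractf[symmetric]
    by (intro sum.cong refl) (simp add: two_term_def algebra_simps)
  then show ?thesis using assms by (simp add: sum_unit_diff)
qed

text \<open>The entry at index 0 is \<open>b - a\<close>, which is not positive, so \<open>a\<close>
  is the only entry that can contribute to the mass.\<close>

lemma q_relation_two_term:
  assumes "p < m" "r < m" "0 < p" "0 < r" "p \<noteq> r" "0 \<le> b" "b \<le> a" "a \<le> int q"
  shows "q_relation m q (two_term a p b r)"
proof -
  have "(\<Sum>i<m. two_term a p b r i) = 0"
    using sum_two_term[OF assms(1,2), of a b "\<lambda>_. 1 :: int"] by simp
  moreover have "\<forall>i\<ge>m. two_term a p b r i = 0"
    using assms by (auto simp: two_term_def unit_diff_def)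
  moreover have "mass m (two_term a p b r) \<le> int q"
  proof -
    have "mass m (two_term a p b r) \<le> (\<Sum>i<m. if i = p then a else 0)"
      unfolding mass_def using assms
      by (intro sum_mono) (auto simp: two_term_def unit_diff_def)
    then show ?thesis using assms by (simp add: sum.delta)
  qed
  ultimately show ?thesis by (simp add: q_relation_def balanced_def)
qed

section \<open>The extremal alphabet and its rank\<close>

definition ladder :: "nat \<Rightarrow> nat \<Rightarrow> int" where
  "ladder q i = (if i < 2 then int i else int q ^ (i - 2) * (int q + 1))"

definition ladder_relation :: "nat \<Rightarrow> nat \<Rightarrow> nat \<Rightarrow> int" where
  "ladder_relation q i = two_term (int q) (i + 2) 1 (i + 3)"

lemma alphabet_ladder:
  assumes "2 \<le> q"
  shows "alphabet m (ladder q)"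
proof -
  have "ladder q i < ladder q (Suc i)" for i
  proof -
    consider "i = 0" | "i = 1" | "2 \<le> i" by linarith
    then show ?thesis
    proof cases
      case 3
      define k where "k = i - 2"
      have i: "i = k + 2" using 3 by (simp add: k_def)
      have "int q ^ k * (int q + 1) * 1 < int q ^ k * (int q + 1) * int q"
        using assms by (intro mult_strict_left_mono) auto
      then show ?thesis by (simp add: i ladder_def Suc_diff_le mult.assoc mult.commute mult.left_commute)
    qed (use assms in \<open>auto simp: ladder_def\<close>)
  qed
  then have "strict_mono (ladder q)" by (rule strict_mono_Suc_iff[THEN iffD2, rule_format])
  then show ?thesis by (auto simp: alphabet_def strict_mono_def strict_mono_on_def)
qed

lemma deleted_row_ladder_relation:
  "deleted_row (ladder_relation q i) j = (if j = i + 1 then of_nat q else if j = i + 2 then - 1 else 0)"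
  by (auto simp: deleted_row_def ladder_relation_def two_term_def unit_diff_def)

lemma inj_ladder_relation: "inj (\<lambda>i. deleted_row (ladder_relation q i))"
proof (rule linorder_injI)
  fix i j :: nat assume "i < j"
  then have "deleted_row (ladder_relation q i) (j + 2) \<noteq> deleted_row (ladder_relation q j) (j + 2)"
    by (simp add: deleted_row_ladder_relation)
  then show "deleted_row (ladder_relation q i) \<noteq> deleted_row (ladder_relation q j)" by metis
qed

text \<open>The rows form a staircase: row \<open>n\<close> ends with -1 in position
  \<open>n + 2\<close>, where all earlier rows are 0.\<close>

lemma independent_ladder_relations:
  "ratvec.independent ((\<lambda>i. deleted_row (ladder_relation q i)) ` {..<n})"
proof (induction n)
  case (Suc n)
  have "deleted_row (ladder_relation q n) \<notin> ratvec.span ((\<lambda>i. deleted_row (ladder_relation q i)) ` {..<n})"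
  proof
    assume "deleted_row (ladder_relation q n) \<in> ratvec.span ((\<lambda>i. deleted_row (ladder_relation q i)) ` {..<n})"
    then have "(\<Sum>j<n + 3. deleted_row (ladder_relation q n) j * of_bool (j = n + 2)) = 0"
      by (rule span_functional_zero) (auto simp: deleted_row_ladder_relation intro!: sum.neutral)
    moreover have "(\<Sum>j<n + 3. deleted_row (ladder_relation q n) j * of_bool (j = n + 2))
        = (\<Sum>j<n + 3. if j = n + 2 then - 1 else 0)"
      by (intro sum.cong) (auto simp: deleted_row_ladder_relation)
    ultimately show False by (simp add: sum.delta)
  qed
  then show ?case
    unfolding lessThan_Suc image_insert using Suc.IH by (rule ratvec.independent_insertI)
qed (simp add: ratvec.independent_empty)

text \<open>Elimination from the top: adding a multiple of the last row clears the top entry and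
  moves \<open>q\<close> times it one position down, which preserves the weighted sum. In the end
  one entry is left, and the sum forces it to be 0.\<close>

lemma span_ladder_relations:
  assumes "f 0 = 0" "\<And>j. n + 2 \<le> j \<Longrightarrow> f j = 0" "(\<Sum>k\<le>n. f (Suc k) * of_nat q ^ k) = 0"
  shows "f \<in> ratvec.span ((\<lambda>i. deleted_row (ladder_relation q i)) ` {..<n})"
  using assms
proof (induction n arbitrary: f)
  case 0
  have "f j = 0" for j
  proof -
    consider "j = 0" | "j = 1" | "2 \<le> j" by linarith
    then show ?thesis
    proof cases
      case 2
      then show ?thesis using 0(3) by simp
    qed (use 0(1) 0(2)[of j] in auto)
  qed
  then have "f = 0" by (intro ext) simp
  show ?case unfolding \<open>f = 0\<close> by (rule ratvec.span_zero)
next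
  case (Suc n)
  let ?b = "deleted_row (ladder_relation q n)"
  let ?g = "f + rat_scale (f (n + 2)) ?b"
  have "?g \<in> ratvec.span ((\<lambda>i. deleted_row (ladder_relation q i)) ` {..<n})"
  proof (rule Suc.IH)
    show "?g 0 = 0" using Suc.prems(1) by (simp add: rat_scale_def deleted_row_ladder_relation)
    show "?g j = 0" if "n + 2 \<le> j" for j
      using that Suc.prems(2)[of j] by (auto simp: rat_scale_def deleted_row_ladder_relation)
    have "(\<Sum>k<n. ?g (Suc k) * of_nat q ^ k) = (\<Sum>k<n. f (Suc k) * of_nat q ^ k)"
      by (intro sum.cong) (auto simp: rat_scale_def deleted_row_ladder_relation)
    then show "(\<Sum>k\<le>n. ?g (Suc k) * of_nat q ^ k) = 0"
      using Suc.prems(3)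
      by (simp add: lessThan_Suc_atMost[symmetric] rat_scale_def deleted_row_ladder_relation algebra_simps)
  qed
  then have g: "?g \<in> ratvec.span ((\<lambda>i. deleted_row (ladder_relation q i)) ` {..<Suc n})"
    by (rule ratvec.span_mono[THEN subsetD, rotated]) auto
  have "rat_scale (f (n + 2)) ?b \<in> ratvec.span ((\<lambda>i. deleted_row (ladder_relation q i)) ` {..<Suc n})"
    by (intro ratvec.span_scale ratvec.span_base) auto
  from ratvec.span_diff[OF g this] show ?case by simp
qed

lemma ladder_relation_vanishes:
  fixes T :: "nat \<Rightarrow> 'a::comm_ring_1"
  assumes "i + 3 < m"
  shows "vanishes_on m (ladder_relation q i) T \<longleftrightarrow> of_nat q * (T (i + 2) - T 0) = T (i + 3) - T 0"
  using assms by (simp add: vanishes_on_def ladder_relation_def sum_two_term)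

lemma q_relation_ladder_relation:
  assumes "2 \<le> q" "i + 3 < m"
  shows "q_relation m q (ladder_relation q i)"
  unfolding ladder_relation_def by (rule q_relation_two_term) (use assms in auto)

lemma vanishes_on_of_int: "vanishes_on m \<delta> (\<lambda>i. real_of_int (T i)) \<longleftrightarrow> vanishes_on m \<delta> T"
proof -
  have "(\<Sum>i<m. of_int (\<delta> i) * real_of_int (T i)) = of_int (\<Sum>i<m. of_int (\<delta> i) * T i)"
    by simp
  then show ?thesis unfolding vanishes_on_def by (metis of_int_eq_0_iff)
qed

text \<open>Every letter from index 2 on is a multiple of \<open>q + 1\<close>, so
  \<open>q + 1\<close> divides \<open>\<delta> 1\<close>, whose absolute value is at most
  \<open>q\<close>.\<close>

lemma vanishing_on_ladder:
  assumes rel: "q_relation (n + 3) q \<delta>" and van: "vanishes_on (n + 3) \<delta> (ladder q)"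
  shows "\<delta> 1 = 0" "(\<Sum>k\<le>n. \<delta> (k + 2) * int q ^ k) = 0"
proof -
  let ?s = "\<Sum>k\<le>n. \<delta> (k + 2) * int q ^ k"
  have "(\<Sum>i<n + 3. \<delta> i * ladder q i) = \<delta> 1 + (\<Sum>k<n + 1. \<delta> (k + 2) * ladder q (k + 2))"
    using sum.lessThan_Suc_shift[of "\<lambda>i. \<delta> i * ladder q i" "n + 2"]
      sum.lessThan_Suc_shift[of "\<lambda>i. \<delta> (Suc i) * ladder q (Suc i)" "n + 1"]
    by (simp add: ladder_def eval_nat_numeral del: sum.lessThan_Suc)
  also have "(\<Sum>k<n + 1. \<delta> (k + 2) * ladder q (k + 2)) = (int q + 1) * ?s"
    by (simp add: sum_distrib_left lessThan_Suc_atMost ladder_def algebra_simps)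
  finally have eq: "\<delta> 1 + (int q + 1) * ?s = 0"
    using van by (simp add: vanishes_on_def)
  have "\<delta> 1 = (int q + 1) * (- ?s)" using eq by simp
  then have "int q + 1 dvd \<delta> 1" by (rule dvdI)
  moreover have "\<bar>\<delta> 1\<bar> < int q + 1" using q_relation_abs_le[OF rel, of 1] by simp
  ultimately show "\<delta> 1 = 0"
    using dvd_imp_le_int[of "\<delta> 1" "int q + 1"] by linarith
  then show "?s = 0" using eq by auto
qed

lemma short_relation_rank_ladder:
  assumes "2 \<le> q"
  shows "short_relation_rank (n + 3) q (\<lambda>i. real_of_int (ladder q i)) = n"
proof -
  let ?T = "\<lambda>i. real_of_int (ladder q i)"
  let ?R = "{\<delta>. q_relation (n + 3) q \<delta> \<and> vanishes_on (n + 3) \<delta> ?T}"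
  let ?B = "(\<lambda>i. deleted_row (ladder_relation q i)) ` {..<n}"
  have "ladder_relation q i \<in> ?R" if "i < n" for i
    using that assms by (simp add: q_relation_ladder_relation ladder_relation_vanishes ladder_def)
  then have "?B \<subseteq> deleted_row ` ?R" by blast
  moreover have "deleted_row ` ?R \<subseteq> ratvec.span ?B"
  proof (intro image_subsetI span_ladder_relations)
    fix \<delta> assume "\<delta> \<in> ?R"
    then have rel: "q_relation (n + 3) q \<delta>" and van: "vanishes_on (n + 3) \<delta> (ladder q)"
      by (auto simp: vanishes_on_of_int)
    show "deleted_row \<delta> 0 = 0" using vanishing_on_ladder(1)[OF rel van] by (simp add: deleted_row_def)
    show "deleted_row \<delta> j = 0" if "n + 2 \<le> j" for j
      using rel that by (simp add: deleted_row_def q_relation_def balanced_def)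
    have "(\<Sum>k\<le>n. deleted_row \<delta> (Suc k) * of_nat q ^ k) = of_int (\<Sum>k\<le>n. \<delta> (k + 2) * int q ^ k)"
      by (simp add: deleted_row_def)
    then show "(\<Sum>k\<le>n. deleted_row \<delta> (Suc k) * of_nat q ^ k) = 0"
      unfolding vanishing_on_ladder(2)[OF rel van] by simp
  qed
  ultimately have span: "ratvec.span ?B = relation_space (n + 3) q ?T"
    unfolding relation_space_def using ratvec.span_superset[of "deleted_row ` ?R"]
    by (subst ratvec.span_eq) blast
  have "ratvec.dim (ratvec.span ?B) = card ?B"
    by (rule ratvec.dim_span_eq_card_independent[OF independent_ladder_relations])
  also have "card ?B = n"
    using card_image[OF inj_on_subset[OF inj_ladder_relation subset_UNIV]] by simp
  finally show ?thesis by (simp add: short_relation_rank_def span)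
qed

section \<open>The lower bound for models of the extremal alphabet\<close>

lemma ladder_model_diameter:
  assumes q: "2 \<le> q" and model: "integer_q_model (n + 3) q (\<lambda>i. real_of_int (ladder q i)) T'"
  shows "int q ^ n * (int q + 1) \<le> diameter (n + 3) T'"
proof -
  let ?T = "\<lambda>i. real_of_int (ladder q i)"
  have van: "vanishes_on (n + 3) \<delta> ?T \<longleftrightarrow> vanishes_on (n + 3) \<delta> T'" if "q_relation (n + 3) q \<delta>" for \<delta>
    using model that by (simp add: integer_q_model_def q_relation_def)
  define x where "x = T' 1 - T' 0"
  define y where "y = T' 2 - T' 0"
  have mono: "T' i < T' j" if "i < j" "j < n + 3" for i j
    using model that by (auto simp: integer_q_model_def alphabet_def strict_mono_on_def)
  have x: "0 < x" and xy: "x < y"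
    using mono[of 0 1] mono[of 1 2] by (auto simp: x_def y_def)
  have "int q + 1 \<le> y"
  proof (rule ccontr)
    assume "\<not> int q + 1 \<le> y"
    \<comment> \<open>This vector has mass at most \<open>q\<close> because \<open>x < y\<close> and
      \<open>y \<le> q\<close>, and it vanishes on \<open>T'\<close> by the choice of
      \<open>x\<close> and \<open>y\<close>.\<close>
    then have rel: "q_relation (n + 3) q (two_term y 1 x 2)"
      using x xy by (intro q_relation_two_term) auto
    have "vanishes_on (n + 3) (two_term y 1 x 2) T'"
      unfolding vanishes_on_def by (subst sum_two_term) (auto simp: x_def y_def)
    then have "vanishes_on (n + 3) (two_term y 1 x 2) (ladder q)"
      using van[OF rel] by (simp add: vanishes_on_of_int)
    \<comment> \<open>On the ladder the first two distances are 1 and \<open>q + 1\<close>, so the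
      same relation makes \<open>y\<close> a positive multiple of \<open>q + 1\<close>.\<close>
    then have "y - x * (int q + 1) = 0"
      using sum_two_term[of 1 "n + 3" 2 y x "ladder q"] by (simp add: vanishes_on_def ladder_def)
    moreover have "1 * (int q + 1) \<le> x * (int q + 1)"
      using x by (intro mult_right_mono) auto
    ultimately show False using \<open>\<not> int q + 1 \<le> y\<close> by simp
  qed
  have "T' (i + 2) - T' 0 = int q ^ i * y" if "i \<le> n" for i
    using that
  proof (induction i)
    case 0
    then show ?case by (simp add: y_def numeral_2_eq_2)
  next
    case (Suc i)
    then have "vanishes_on (n + 3) (ladder_relation q i) T'"
      using q by (subst van[symmetric])
        (simp_all add: q_relation_ladder_relation ladder_relation_vanishes ladder_def)
    then have "int q * (T' (i + 2) - T' 0) = T' (i + 3) - T' 0"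
      using Suc.prems by (simp add: ladder_relation_vanishes)
    then show ?case using Suc by (simp add: eval_nat_numeral)
  qed
  from this[of n] have "diameter (n + 3) T' = int q ^ n * y"
    by (simp add: diameter_def)
  then show ?thesis using \<open>int q + 1 \<le> y\<close> by (simp add: mult_left_mono)
qed

theorem theorem4p1:
  fixes m q :: nat
  assumes "m \<ge> 3" and "q \<ge> 2"
  shows
    "(\<forall>T :: nat \<Rightarrow> real. alphabet m T \<and> short_relation_rank m q T = m - 3 \<longrightarrow>
        (\<exists>d. short_relation_basis m q T (m - 3) d) \<and>
        (\<forall>d H. short_relation_basis m q T (m - 3) d \<and> H = (\<Prod>i<m - 3. mass m (d i)) \<longrightarrow>
           (\<exists>T'. integer_q_model m q T T' \<and> primitive m T' \<and>
                 diameter m T' \<le> (int q + 1) * H) \<and>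
           (int q + 1) * H \<le> int q ^ (m - 3) * (int q + 1))) \<and>
     (\<exists>T :: nat \<Rightarrow> real. alphabet m T \<and> short_relation_rank m q T = m - 3 \<and>
        (\<exists>T'. integer_q_model m q T T' \<and>
              diameter m T' = int q ^ (m - 3) * (int q + 1)) \<and>
        (\<forall>T'. integer_q_model m q T T' \<longrightarrow>
              int q ^ (m - 3) * (int q + 1) \<le> diameter m T'))"
proof (intro conjI allI impI)
  fix T :: "nat \<Rightarrow> real"
  assume T: "alphabet m T \<and> short_relation_rank m q T = m - 3"
  then show "\<exists>d. short_relation_basis m q T (m - 3) d"
    by (simp add: exists_short_relation_basis)
  fix d H
  assume d: "short_relation_basis m q T (m - 3) d \<and> H = (\<Prod>i<m - 3. mass m (d i))"
  interpret short_basis m q T d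
    using assms T d by unfold_locales auto
  show "\<exists>T'. integer_q_model m q T T' \<and> primitive m T' \<and> diameter m T' \<le> (int q + 1) * H"
    using exists_primitive_model d by simp
  \<comment> \<open>Every basis relation has mass at most \<open>q\<close>, which bounds
    \<open>H\<close> by a power of \<open>q\<close>.\<close>
  have "(\<Prod>i<m - 3. mass m (d i)) \<le> (\<Prod>i<m - 3. int q)"
    using basis_relation(1) by (intro prod_mono) (auto simp: mass_nonneg q_relation_def)
  then show "(int q + 1) * H \<le> int q ^ (m - 3) * (int q + 1)"
    using d by (simp add: mult.commute mult_left_mono)
next
  define n where "n = m - 3"
  have m: "m = n + 3" using assms by (simp add: n_def)
  let ?T = "\<lambda>i. real_of_int (ladder q i)"
  \<comment> \<open>The ladder consists of integers and is therefore a model of itself, which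
    attains the bound.\<close>
  have "alphabet m ?T" "integer_q_model m q ?T (ladder q)"
    using alphabet_ladder[OF assms(2), of m]
    by (auto simp: integer_q_model_def vanishes_on_of_int alphabet_def strict_mono_on_def)
  moreover have "diameter m (ladder q) = int q ^ n * (int q + 1)"
    by (simp add: m diameter_def ladder_def)
  ultimately show "\<exists>T :: nat \<Rightarrow> real. alphabet m T \<and> short_relation_rank m q T = m - 3 \<and>
        (\<exists>T'. integer_q_model m q T T' \<and>
              diameter m T' = int q ^ (m - 3) * (int q + 1)) \<and>
        (\<forall>T'. integer_q_model m q T T' \<longrightarrow>
              int q ^ (m - 3) * (int q + 1) \<le> diameter m T')"
    using short_relation_rank_ladder[OF assms(2), of n] ladder_model_diameter[OF assms(2), of n]
    by (intro exI[of _ ?T]) (auto simp: m)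
qed

end
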